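(* Let $(S^x_n)_{n\ge 0}$, $x\in\mathbb N_0^2$, be the identically reflected quadrant walk with data $(p,q)$ (as defined in the context), let $Z_x$ be its number of boundary contacts, and let $f_n(x)=\mathbf P(Z_x=n)$. Let $\eta$ be a $\mathbb Z^2$-valued random variable with $\mathbf P(\eta=(k,\ell))=q_{k,\ell}$. Then for all $x\in\mathbb N_0^2$, $$f_1(x)=\mathbf E f_0(x+\eta)-f_0(x),\qquad f_{n+1}(x)=\mathbf E f_n(x+\eta)\quad (n\ge 1).$$ As a consequence, if $(\eta_k)_{k\ge 1}$ are independent copies of $\eta$, then $$\mathbf P(Z_x\le n)=\sum_{k=0}^n f_k(x)=\mathbf E f_0\Bigl(x+\sum_{k=1}^n\eta_k\Bigr),\qquad n\ge 1,\ x\in\mathbb N_0^2.$$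
   Context: $\mathbb N=\{1,2,\dots\}$, $\mathbb N_0=\{0,1,2,\dots\}$. **Identically reflected quadrant walk with data $(p,q)$.** Let $\{p_{k,\ell}\}_{(k,\ell)\in\mathbb Z^2}$ and $\{q_{k,\ell}\}_{(k,\ell)\in\mathbb Z^2}$ be non-negative weights such that: (1) $\sum_{k,\ell}p_{k,\ell}=\sum_{k,\ell}q_{k,\ell}=1$; (2) $p_{k,\ell}=0$ whenever $k\le -2$ or $\ell\le -2$; (3) $p_{k,-1}\,p_{-1,\ell}>0$ for some $k,\ell$; (4) $\sum_{k,\ell}k\,p_{k,\ell}\in(0,\infty)$ and $\sum_{k,\ell}\ell\,p_{k,\ell}\in(0,\infty)$; (5) $q_{k,\ell}=0$ whenever $k\le -1$ or $\ell\le -1$; (6) $\sum_{k,\ell}k\,q_{k,\ell}\in(0,\infty)$ and $\sum_{k,\ell}\ell\,q_{k,\ell}\in(0,\infty)$. Let $(\xi_n)$ be i.i.d. with $\mathbf P(\xi_n=(k,\ell))=p_{k,\ell}$ and $(\eta_n)$ i.i.d. with $\mathbf P(\eta_n=(k,\ell))=q_{k,\ell}$, all independent. For $x\in\mathbb N_0^2$ set $S_0^x=x$ and $$S_{n+1}^x=S_n^x+\xi_{n+1}\mathbf 1_{\{S_n^x\in\mathbb N^2\}}+\eta_{n+1}\mathbf 1_{\{S_n^x\in\mathbb N_0^2\setminus\mathbb N^2\}},\quad n\ge 0.$$ The number of boundary contacts is $Z_x=\sum_{n\ge 0}\mathbf 1_{\{S_n^x\in\mathbb N_0^2\setminus\mathbb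 N^2\}}$ (the starting point counts as a contact if it lies on the boundary). *)

theory Defs
  imports "HOL-Probability.Probability"
begin

definition quadrant :: "(int \<times> int) set" where
  "quadrant = {0..} \<times> {0..}"

definition quadrant_interior :: "(int \<times> int) set" where
  "quadrant_interior = {1..} \<times> {1..}"

definition quadrant_boundary :: "(int \<times> int) set" where
  "quadrant_boundary = quadrant - quadrant_interior"

text \<open>
  The first coordinate of a step is at least \<open>-1\<close> on the support of \<open>p\<close> and at least \<open>0\<close> on that
  of \<open>q\<close>, and likewise for the second. Hence the mean of a coordinate always exists in
  \<open>(-\<infinity>, \<infinity>]\<close>, and its lying in \<open>(0, \<infinity>)\<close> means that the series is (absolutely) summable with a
  positive sum. Summability has to be stated, since \<^const>\<open>infsum\<close> is \<open>0\<close> on divergent families.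
\<close>

locale quadrant_walk_data =
  fixes p q :: "int \<times> int \<Rightarrow> real"
  assumes p_nonneg: "\<And>z. p z \<ge> 0"
    and q_nonneg: "\<And>z. q z \<ge> 0"
    and p_total: "(p has_sum 1) UNIV"
    and q_total: "(q has_sum 1) UNIV"
    and p_support: "\<And>k l. k \<le> -2 \<or> l \<le> -2 \<Longrightarrow> p (k, l) = 0"
    and p_backward: "\<exists>k l. p (k, -1) * p (-1, l) > 0"
    and p_drift_fst: "(\<lambda>(k, l). of_int k * p (k, l)) summable_on UNIV"
      "(\<Sum>\<^sub>\<infinity>(k, l)\<in>UNIV. of_int k * p (k, l)) > 0"
    and p_drift_snd: "(\<lambda>(k, l). of_int l * p (k, l)) summable_on UNIV"
      "(\<Sum>\<^sub>\<infinity>(k, l)\<in>UNIV. of_int l * p (k, l)) > 0"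
    and q_support: "\<And>k l. k \<le> -1 \<or> l \<le> -1 \<Longrightarrow> q (k, l) = 0"
    and q_drift_fst: "(\<lambda>(k, l). of_int k * q (k, l)) summable_on UNIV"
      "(\<Sum>\<^sub>\<infinity>(k, l)\<in>UNIV. of_int k * q (k, l)) > 0"
    and q_drift_snd: "(\<lambda>(k, l). of_int l * q (k, l)) summable_on UNIV"
      "(\<Sum>\<^sub>\<infinity>(k, l)\<in>UNIV. of_int l * q (k, l)) > 0"

definition has_law :: "'a measure \<Rightarrow> ('a \<Rightarrow> int \<times> int) \<Rightarrow> (int \<times> int \<Rightarrow> real) \<Rightarrow> bool" where
  "has_law M X w \<longleftrightarrow> X \<in> measurable M (count_space UNIV) \<and>
     (\<forall>z. measure M {\<omega> \<in> space M. X \<omega> = z} = w z)"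

text \<open>
  The variables \<open>\<xi> n\<close> and \<open>\<eta> n\<close> are only used for \<open>n \<ge> 1\<close>. Indexing the combined family by a sum
  type expresses that all the variables \<open>\<xi> 1, \<xi> 2, \<dots>, \<eta> 1, \<eta> 2, \<dots>\<close> are jointly independent.
\<close>

locale reflected_quadrant_walk = prob_space M + quadrant_walk_data p q
  for M :: "'a measure" and p q :: "int \<times> int \<Rightarrow> real" +
  fixes \<xi> \<eta> :: "nat \<Rightarrow> 'a \<Rightarrow> int \<times> int"
  assumes xi_law: "\<And>n. n \<ge> 1 \<Longrightarrow> has_law M (\<xi> n) p"
    and eta_law: "\<And>n. n \<ge> 1 \<Longrightarrow> has_law M (\<eta> n) q"
    and indep: "indep_vars (\<lambda>_. count_space UNIV) (case_sum \<xi> \<eta>) ({1..} <+> {1..})"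

primrec walk ::
  "(nat \<Rightarrow> 'a \<Rightarrow> int \<times> int) \<Rightarrow> (nat \<Rightarrow> 'a \<Rightarrow> int \<times> int) \<Rightarrow> int \<times> int \<Rightarrow> nat \<Rightarrow> 'a \<Rightarrow> int \<times> int"
where
  "walk \<xi> \<eta> x 0 \<omega> = x"
| "walk \<xi> \<eta> x (Suc n) \<omega> = walk \<xi> \<eta> x n \<omega>
     + (if walk \<xi> \<eta> x n \<omega> \<in> quadrant_interior then \<xi> (Suc n) \<omega> else 0)
     + (if walk \<xi> \<eta> x n \<omega> \<in> quadrant_boundary then \<eta> (Suc n) \<omega> else 0)"

definition contacts ::
  "(nat \<Rightarrow> 'a \<Rightarrow> int \<times> int) \<Rightarrow> (nat \<Rightarrow> 'a \<Rightarrow> int \<times> int) \<Rightarrow> int \<times> int \<Rightarrow> 'a \<Rightarrow> enat"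
where
  "contacts \<xi> \<eta> x \<omega> = (\<Sum>n. if walk \<xi> \<eta> x n \<omega> \<in> quadrant_boundary then 1 else 0)"

definition contact_prob ::
  "'a measure \<Rightarrow> (nat \<Rightarrow> 'a \<Rightarrow> int \<times> int) \<Rightarrow> (nat \<Rightarrow> 'a \<Rightarrow> int \<times> int) \<Rightarrow> nat \<Rightarrow> int \<times> int \<Rightarrow> real"
where
  "contact_prob M \<xi> \<eta> n x = measure M {\<omega> \<in> space M. contacts \<xi> \<eta> x \<omega> = enat n}"

end

theory Submission
  imports Defs
begin

text \<open>
  Starting a walk from \<open>x + \<eta>\<close> amounts to performing the first reflection in advance, so one contact
  and one time unit are saved. Since both drivers are i.i.d., this is an exact identity in law at
  every finite horizon: the number of contacts before time \<open>T + 1\<close> from \<open>x\<close>, decreased by one if it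
  is positive, is distributed as the number of contacts before time \<open>T\<close> from \<open>x + \<eta>\<close>. Induction
  on \<open>T\<close> proves it, exchanging the next step \<open>\<xi>\<close> with \<open>\<eta>\<close> in the interior, and no hitting time of
  the boundary is needed. Letting \<open>T \<rightarrow> \<infinity>\<close> shows that averaging \<open>P(Z\<^sub>x \<le> m)\<close> over the starting
  points \<open>x + \<eta>\<^sub>1 + \<dots> + \<eta>\<^sub>n\<close> gives \<open>P(Z\<^sub>x \<le> m + n)\<close>.
\<close>

section \<open>Laws of countably valued random variables as mass functions\<close>

definition law :: "'a measure \<Rightarrow> ('a \<Rightarrow> 'b::countable) \<Rightarrow> 'b pmf" where
  "law M X = Abs_pmf (distr M (count_space UNIV) X)"

text \<open>\<open>Abs_pmf\<close> is faithful only for discrete probability measures almost all of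
  whose points are atoms. Countability of the codomain gives this: the points of mass zero form a
  countable union of null sets.\<close>

lemma measure_pmf_law:
  fixes X :: "'a \<Rightarrow> 'b::countable"
  assumes "prob_space M" and [measurable]: "X \<in> M \<rightarrow>\<^sub>M count_space UNIV"
  shows "measure_pmf (law M X) = distr M (count_space UNIV) X"
proof -
  let ?D = "distr M (count_space UNIV) X"
  interpret D: prob_space ?D
    using assms by (intro prob_space.prob_space_distr)
  have "(\<Union>z\<in>{z. measure ?D {z} = 0}. {z}) \<in> null_sets ?D"
    by (intro null_sets_UN') (auto simp: null_sets_def D.emeasure_eq_measure)
  moreover have "{z \<in> space ?D. \<not> measure ?D {z} \<noteq> 0} \<subseteq> (\<Union>z\<in>{z. measure ?D {z} = 0}. {z})"
    by auto
  ultimately have "AE z in ?D. measure ?D {z} \<noteq> 0"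
    by (rule AE_I')
  then show ?thesis
    unfolding law_def using D.prob_space_axioms by (intro Abs_pmf_inverse) auto
qed

lemma pmf_law:
  fixes X :: "'a \<Rightarrow> 'b::countable"
  assumes "prob_space M" "X \<in> M \<rightarrow>\<^sub>M count_space UNIV"
  shows "pmf (law M X) z = measure M {\<omega> \<in> space M. X \<omega> = z}"
  using assms
  by (auto simp: pmf.rep_eq measure_pmf_law measure_distr intro!: arg_cong[where f = "measure M"])

lemma measure_law:
  fixes X :: "'a \<Rightarrow> 'b::countable"
  assumes "prob_space M" "X \<in> M \<rightarrow>\<^sub>M count_space UNIV"
  shows "measure_pmf.prob (law M X) A = measure M {\<omega> \<in> space M. X \<omega> \<in> A}"
  using assms
  by (auto simp: measure_pmf_law measure_distr intro!: arg_cong[where f = "measure M"])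

lemma integral_law:
  fixes X :: "'a \<Rightarrow> 'b::countable" and g :: "'b \<Rightarrow> real"
  assumes "prob_space M" "X \<in> M \<rightarrow>\<^sub>M count_space UNIV"
  shows "measure_pmf.expectation (law M X) g = prob_space.expectation M (\<lambda>\<omega>. g (X \<omega>))"
  using assms by (simp add: measure_pmf_law integral_distr)

lemma law_compose:
  fixes X :: "'a \<Rightarrow> 'b::countable" and h :: "'b \<Rightarrow> 'c::countable"
  assumes "prob_space M" and [measurable]: "X \<in> M \<rightarrow>\<^sub>M count_space UNIV"
  shows "law M (\<lambda>\<omega>. h (X \<omega>)) = map_pmf h (law M X)"
  by (rule pmf_eqI)
     (simp add: pmf_law[OF assms(1)] pmf_map measure_law[OF assms(1)] vimage_def)

lemma law_const:
  assumes "prob_space M"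
  shows "law M (\<lambda>_. c) = return_pmf c"
  using assms by (intro pmf_eqI) (simp add: pmf_law prob_space.prob_space indicator_def)

lemma measurable_count_space_compose2:
  fixes X :: "'a \<Rightarrow> 'b::countable" and Y :: "'a \<Rightarrow> 'c::countable"
  assumes [measurable]: "X \<in> M \<rightarrow>\<^sub>M count_space UNIV" "Y \<in> M \<rightarrow>\<^sub>M count_space UNIV"
  shows "(\<lambda>\<omega>. h (X \<omega>) (Y \<omega>)) \<in> M \<rightarrow>\<^sub>M count_space UNIV"
  by measurable

text \<open>The independent variables \<open>X\<close> and \<open>Y\<close> may take values in
  arbitrary spaces; only the images under \<open>F\<close> and \<open>G\<close> are countable. This
  is the form needed later, where \<open>X\<close> and \<open>Y\<close> are whole blocks of drivers
  in product spaces.\<close>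

lemma law_pair:
  fixes F :: "'b \<Rightarrow> 'c::countable" and G :: "'b \<Rightarrow> 'd::countable"
  assumes M: "prob_space M"
    and indep: "prob_space.indep_var M S X T Y"
    and F: "F \<in> S \<rightarrow>\<^sub>M count_space UNIV" and G: "G \<in> T \<rightarrow>\<^sub>M count_space UNIV"
  shows "law M (\<lambda>\<omega>. (F (X \<omega>), G (Y \<omega>))) = pair_pmf (law M (\<lambda>\<omega>. F (X \<omega>))) (law M (\<lambda>\<omega>. G (Y \<omega>)))"
proof (rule pmf_eqI)
  interpret prob_space M by fact
  have X: "X \<in> M \<rightarrow>\<^sub>M S" and Y: "Y \<in> M \<rightarrow>\<^sub>M T"
    by (rule indep_var_rv1[OF indep], rule indep_var_rv2[OF indep])
  have FX: "(\<lambda>\<omega>. F (X \<omega>)) \<in> M \<rightarrow>\<^sub>M count_space UNIV"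
    using X F by (rule measurable_compose)
  have GY: "(\<lambda>\<omega>. G (Y \<omega>)) \<in> M \<rightarrow>\<^sub>M count_space UNIV"
    using Y G by (rule measurable_compose)
  have FXGY: "(\<lambda>\<omega>. (F (X \<omega>), G (Y \<omega>))) \<in> M \<rightarrow>\<^sub>M count_space UNIV"
    using FX GY by (rule measurable_count_space_compose2)
  fix z :: "'c \<times> 'd"
  obtain a b where z: "z = (a, b)" by force
  let ?A = "F -` {a} \<inter> space S" and ?B = "G -` {b} \<inter> space T"
  have "prob ((\<lambda>x. (X x, Y x)) -` (?A \<times> ?B) \<inter> space M) =
      prob (X -` ?A \<inter> space M) * prob (Y -` ?B \<inter> space M)"
    using indep measurable_sets[OF F] measurable_sets[OF G] by (intro indep_varD) auto
  moreover have "X \<omega> \<in> space S" "Y \<omega> \<in> space T" if "\<omega> \<in> space M" for \<omega>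
    using that X Y by (auto dest: measurable_space)
  then have "(\<lambda>x. (X x, Y x)) -` (?A \<times> ?B) \<inter> space M = {\<omega> \<in> space M. (F (X \<omega>), G (Y \<omega>)) = z}"
    "X -` ?A \<inter> space M = {\<omega> \<in> space M. F (X \<omega>) = a}"
    "Y -` ?B \<inter> space M = {\<omega> \<in> space M. G (Y \<omega>) = b}"
    using z by auto
  ultimately show "pmf (law M (\<lambda>\<omega>. (F (X \<omega>), G (Y \<omega>)))) z =
      pmf (pair_pmf (law M (\<lambda>\<omega>. F (X \<omega>))) (law M (\<lambda>\<omega>. G (Y \<omega>)))) z"
    by (simp add: z pmf_pair pmf_law[OF M] FX GY FXGY)
qed

lemma has_law_imp_law_eq:
  assumes "prob_space M" "prob_space N" "has_law M X w" "has_law N Y w"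
  shows "law M X = law N Y"
  using assms by (intro pmf_eqI) (simp add: pmf_law has_law_def del: split_paired_All)

lemma map_pmf_plus_0: "map_pmf ((+) (0::'a::monoid_add)) R = R"
  by (rule pmf.map_ident_strong) simp

lemma prob_bind_pmf:
  "measure_pmf.prob (bind_pmf R C) A = measure_pmf.expectation R (\<lambda>y. measure_pmf.prob (C y) A)"
proof -
  \<comment> \<open>Membership in \<open>A\<close> is mapped to a Boolean, so that the probability
    becomes a single mass and \<open>pmf_bind\<close> applies.\<close>
  have "measure_pmf.prob (bind_pmf R C) A = pmf (map_pmf (\<lambda>c. c \<in> A) (bind_pmf R C)) True"
    by (simp add: pmf_map vimage_def)
  also have "\<dots> = measure_pmf.expectation R (\<lambda>y. measure_pmf.prob (C y) A)"
    by (simp add: map_bind_pmf pmf_bind pmf_map vimage_def)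
  finally show ?thesis .
qed

section \<open>Finite-horizon contact counts and their shift by reflection steps\<close>

text \<open>Outside the quadrant the position is frozen, exactly as in \<open>walk\<close>, where
  both indicators vanish there. Thus the transition law agrees with the pathwise recursion at every
  point of the plane.\<close>

definition walk_step :: "(int \<times> int) pmf \<Rightarrow> (int \<times> int) pmf \<Rightarrow> int \<times> int \<Rightarrow> (int \<times> int) pmf" where
  "walk_step P Q s = (if s \<in> quadrant_interior then map_pmf ((+) s) P
     else if s \<in> quadrant_boundary then map_pmf ((+) s) Q else return_pmf s)"

text \<open>The recursion conditions on the first step, the form in which that step can be exchanged
  with a reflection. Times 0 to \<open>T - 1\<close> are counted, hence the starting point but not
  the endpoint.\<close>

primrec visits ::
  "(int \<times> int) pmf \<Rightarrow> (int \<times> int) pmf \<Rightarrow> nat \<Rightarrow> int \<times> int \<Rightarrow> nat pmf" where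
  "visits P Q 0 s = return_pmf 0"
| "visits P Q (Suc T) s =
     map_pmf (\<lambda>c. of_bool (s \<in> quadrant_boundary) + c) (bind_pmf (walk_step P Q s) (visits P Q T))"

primrec conv_power :: "'a::comm_monoid_add pmf \<Rightarrow> nat \<Rightarrow> 'a pmf" where
  "conv_power Q 0 = return_pmf 0"
| "conv_power Q (Suc n) = bind_pmf (conv_power Q n) (\<lambda>y. map_pmf ((+) y) Q)"

lemma quadrant_interior_boundary_disjoint: "s \<in> quadrant_interior \<Longrightarrow> s \<notin> quadrant_boundary"
  by (simp add: quadrant_boundary_def)

lemma interior_add: "s \<in> quadrant_interior \<Longrightarrow> y \<in> quadrant \<Longrightarrow> s + y \<in> quadrant_interior"
  by (cases s; cases y) (auto simp: quadrant_interior_def quadrant_def)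

lemma quadrant_add: "s \<in> quadrant \<Longrightarrow> y \<in> quadrant \<Longrightarrow> s + y \<in> quadrant"
  by (cases s; cases y) (auto simp: quadrant_def)

text \<open>The truncated subtraction covers the walks that do not reach the boundary.\<close>

lemma visits_shift:
  assumes P: "\<And>s y. s \<in> quadrant_interior \<Longrightarrow> y \<in> set_pmf P \<Longrightarrow> s + y \<in> quadrant"
    and Q: "set_pmf Q \<subseteq> quadrant"
  shows "s \<in> quadrant \<Longrightarrow>
    map_pmf (\<lambda>c. c - 1) (visits P Q (Suc T) s) = bind_pmf Q (\<lambda>y. visits P Q T (s + y))"
proof (induction T arbitrary: s)
  case 0
  show ?case
    by (simp add: map_bind_pmf bind_return_pmf pmf.map_comp o_def map_return_pmf)
next
  case (Suc T)
  show ?case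
  proof (cases "s \<in> quadrant_interior")
    case False
    \<comment> \<open>On the boundary the walk's own first move is a \<open>Q\<close> step, and the
      contact at time 0 is precisely the unit that is subtracted.\<close>
    then have "s \<in> quadrant_boundary"
      using Suc.prems by (simp add: quadrant_boundary_def)
    then show ?thesis
      using False unfolding visits.simps(2)[of P Q "Suc T"]
      by (simp add: pmf.map_comp o_def walk_step_def bind_map_pmf del: visits.simps)
  next
    case True
    \<comment> \<open>An interior start contributes no contact, so the subtraction passes through
      the first step.\<close>
    have "map_pmf (\<lambda>c. c - 1) (visits P Q (Suc (Suc T)) s) =
        bind_pmf P (\<lambda>z. map_pmf (\<lambda>c. c - 1) (visits P Q (Suc T) (s + z)))"
      using True quadrant_interior_boundary_disjoint[OF True]
      unfolding visits.simps(2)[of P Q "Suc T"]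
      by (simp add: walk_step_def map_bind_pmf bind_map_pmf pmf.map_comp o_def del: visits.simps)
    also have "\<dots> = bind_pmf P (\<lambda>z. bind_pmf Q (\<lambda>y. visits P Q T (s + z + y)))"
      using P[OF True] by (intro bind_pmf_cong refl Suc.IH)
    also have "\<dots> = bind_pmf Q (\<lambda>y. bind_pmf P (\<lambda>z. visits P Q T ((s + y) + z)))"
      by (subst bind_commute_pmf) (simp add: ac_simps)
    also have "\<dots> = bind_pmf Q (\<lambda>y. visits P Q (Suc T) (s + y))"
    proof (intro bind_pmf_cong refl)
      fix y assume "y \<in> set_pmf Q"
      \<comment> \<open>Reflection steps have non-negative coordinates: \<open>s + y\<close> is
        again interior, so the walk started there also moves by \<open>P\<close> and records no
        contact at time 0.\<close>
      then have *: "s + y \<in> quadrant_interior"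
        using True Q by (intro interior_add) auto
      then show "bind_pmf P (\<lambda>z. visits P Q T ((s + y) + z)) = visits P Q (Suc T) (s + y)"
        using quadrant_interior_boundary_disjoint[OF *] by (simp add: walk_step_def bind_map_pmf)
    qed
    finally show ?thesis .
  qed
qed

text \<open>Truncated subtractions compose, so \<open>visits_shift\<close> can be iterated. Removing
  one more contact costs one more time unit, which is why the induction hypothesis is needed at
  horizon \<open>Suc T\<close>.\<close>

lemma visits_shift_power:
  assumes P: "\<And>s y. s \<in> quadrant_interior \<Longrightarrow> y \<in> set_pmf P \<Longrightarrow> s + y \<in> quadrant"
    and Q: "set_pmf Q \<subseteq> quadrant"
  shows "s \<in> quadrant \<Longrightarrow>
    map_pmf (\<lambda>c. c - n) (visits P Q (T + n) s) = bind_pmf (conv_power Q n) (\<lambda>y. visits P Q T (s + y))"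
proof (induction n arbitrary: T)
  case 0
  then show ?case by (simp add: bind_return_pmf)
next
  case (Suc n)
  \<comment> \<open>This keeps every shifted starting point in the quadrant, where
    \<open>visits_shift\<close> holds.\<close>
  have supp: "set_pmf (conv_power Q n) \<subseteq> quadrant"
  proof (induction n)
    case 0
    then show ?case by (simp add: quadrant_def zero_prod_def)
  next
    case (Suc n)
    have "y + z \<in> quadrant" if "y \<in> set_pmf (conv_power Q n)" "z \<in> set_pmf Q" for y z
      using that Suc Q by (blast intro: quadrant_add)
    then show ?case by (simp add: UN_subset_iff image_subset_iff)
  qed
  have "map_pmf (\<lambda>c. c - Suc n) (visits P Q (T + Suc n) s) =
      map_pmf (\<lambda>c. c - 1) (map_pmf (\<lambda>c. c - n) (visits P Q (Suc T + n) s))"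
    by (simp add: pmf.map_comp o_def del: visits.simps)
  also have "\<dots> = bind_pmf (conv_power Q n)
      (\<lambda>y. map_pmf (\<lambda>c. c - 1) (visits P Q (Suc T) (s + y)))"
    unfolding Suc.IH[OF Suc.prems] by (simp add: map_bind_pmf del: visits.simps)
  also have "\<dots> = bind_pmf (conv_power Q n) (\<lambda>y. bind_pmf Q (\<lambda>z. visits P Q T (s + y + z)))"
    using supp Suc.prems by (intro bind_pmf_cong refl visits_shift[OF P Q] quadrant_add) auto
  finally show ?case
    by (simp add: bind_assoc_pmf bind_map_pmf ac_simps)
qed

section \<open>The pathwise count and its joint evolution with the position\<close>

definition contacts_upto ::
  "(nat \<Rightarrow> 'a \<Rightarrow> int \<times> int) \<Rightarrow> (nat \<Rightarrow> 'a \<Rightarrow> int \<times> int) \<Rightarrow> int \<times> int \<Rightarrow> nat \<Rightarrow> 'a \<Rightarrow> nat"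
where
  "contacts_upto \<xi> \<eta> x T \<omega> = (\<Sum>n<T. of_bool (walk \<xi> \<eta> x n \<omega> \<in> quadrant_boundary))"

text \<open>An \<open>enat\<close> series of non-negative terms is the supremum of its partial sums.
  The event on the total count, which may be infinite, thus becomes a countable intersection of
  finite-horizon events.\<close>

lemma contacts_le_iff: "contacts \<xi> \<eta> x \<omega> \<le> enat n \<longleftrightarrow> (\<forall>T. contacts_upto \<xi> \<eta> x T \<omega> \<le> n)"
proof -
  let ?g = "\<lambda>n. (if walk \<xi> \<eta> x n \<omega> \<in> quadrant_boundary then 1 else 0) :: enat"
  have eq: "sum ?g {..<T} = enat (contacts_upto \<xi> \<eta> x T \<omega>)" for T
    unfolding contacts_upto_def
    by (induction T) (auto simp: zero_enat_def one_enat_def)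
  show ?thesis
  proof
    assume *: "contacts \<xi> \<eta> x \<omega> \<le> enat n"
    show "\<forall>T. contacts_upto \<xi> \<eta> x T \<omega> \<le> n"
    proof
      fix T
      have "sum ?g {..<T} \<le> suminf ?g"
        by (rule sum_le_suminf) auto
      then have "enat (contacts_upto \<xi> \<eta> x T \<omega>) \<le> contacts \<xi> \<eta> x \<omega>"
        unfolding eq contacts_def .
      from order_trans[OF this *] show "contacts_upto \<xi> \<eta> x T \<omega> \<le> n"
        by simp
    qed
  next
    assume "\<forall>T. contacts_upto \<xi> \<eta> x T \<omega> \<le> n"
    then show "contacts \<xi> \<eta> x \<omega> \<le> enat n"
      unfolding contacts_def by (intro suminf_le_const) (auto simp: eq)
  qed
qed

text \<open>The next contact depends on the position, so the Markov chain is the pair. The position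
  at time \<open>T\<close> is not yet counted; \<open>update\<close> counts it on departure.\<close>

definition walk_state ::
  "(nat \<Rightarrow> 'a \<Rightarrow> int \<times> int) \<Rightarrow> (nat \<Rightarrow> 'a \<Rightarrow> int \<times> int) \<Rightarrow> int \<times> int \<Rightarrow> nat \<Rightarrow> 'a \<Rightarrow> (int \<times> int) \<times> nat"
where
  "walk_state \<xi> \<eta> x T \<omega> = (walk \<xi> \<eta> x T \<omega>, contacts_upto \<xi> \<eta> x T \<omega>)"

definition update :: "(int \<times> int) \<times> nat \<Rightarrow> (int \<times> int) \<times> (int \<times> int) \<Rightarrow> (int \<times> int) \<times> nat" where
  "update = (\<lambda>(s, c) (u, v).
     (s + (if s \<in> quadrant_interior then u else 0) + (if s \<in> quadrant_boundary then v else 0),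
      of_bool (s \<in> quadrant_boundary) + c))"

lemma walk_state_Suc:
  "walk_state \<xi> \<eta> x (Suc T) \<omega> = update (walk_state \<xi> \<eta> x T \<omega>) (\<xi> (Suc T) \<omega>, \<eta> (Suc T) \<omega>)"
  by (simp add: walk_state_def update_def contacts_upto_def)

text \<open>The hypotheses mention only the drivers with index in \<open>{1..T}\<close>, so that the
  lemma also covers coordinate maps on a finite product space.\<close>

lemma measurable_walk_state:
  assumes "\<And>n. n \<in> {1..T} \<Longrightarrow> \<xi> n \<in> M \<rightarrow>\<^sub>M count_space UNIV"
    and "\<And>n. n \<in> {1..T} \<Longrightarrow> \<eta> n \<in> M \<rightarrow>\<^sub>M count_space UNIV"
  shows "walk_state \<xi> \<eta> x T \<in> M \<rightarrow>\<^sub>M count_space UNIV"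
  using assms
proof (induction T)
  case 0
  have "walk_state \<xi> \<eta> x 0 = (\<lambda>\<omega>. (x, 0))"
    by (auto simp: walk_state_def contacts_upto_def)
  then show ?case by simp
next
  case (Suc T)
  have "walk_state \<xi> \<eta> x (Suc T) =
      (\<lambda>\<omega>. update (walk_state \<xi> \<eta> x T \<omega>) (\<xi> (Suc T) \<omega>, \<eta> (Suc T) \<omega>))"
    by (rule ext) (rule walk_state_Suc)
  also have "\<dots> \<in> M \<rightarrow>\<^sub>M count_space UNIV"
    using Suc by (intro measurable_count_space_compose2[where h = update]
        measurable_count_space_compose2[where h = Pair]) auto
  finally show ?case .
qed

lemma walk_state_cong:
  assumes "\<And>n. n \<in> {1..T} \<Longrightarrow> \<xi> n \<omega> = \<xi>' n \<omega>'" "\<And>n. n \<in> {1..T} \<Longrightarrow> \<eta> n \<omega> = \<eta>' n \<omega>'"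
  shows "walk_state \<xi> \<eta> x T \<omega> = walk_state \<xi>' \<eta>' x T \<omega>'"
  using assms
proof (induction T)
  case 0
  then show ?case by (simp add: walk_state_def contacts_upto_def)
next
  case (Suc T)
  then show ?case by (simp add: walk_state_Suc)
qed

text \<open>The interior and the boundary are disjoint, so at most one component of the driver pair
  enters a step; hence the marginals of \<open>J\<close> determine the result.\<close>

lemma map_update:
  assumes "map_pmf fst J = P" "map_pmf snd J = Q"
  shows "map_pmf (update (s, c)) J =
    map_pmf (\<lambda>y. (y, of_bool (s \<in> quadrant_boundary) + c)) (walk_step P Q s)"
  using assms quadrant_interior_boundary_disjoint[of s]
  by (auto simp: update_def walk_step_def pmf.map_comp o_def case_prod_unfold)

section \<open>Markov property of the walk and the law of its finite-horizon counts\<close>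

context reflected_quadrant_walk
begin

definition "P = law M (\<xi> 1)"
definition "Q = law M (\<eta> 1)"

lemma measurable_xi: "n \<ge> 1 \<Longrightarrow> \<xi> n \<in> M \<rightarrow>\<^sub>M count_space UNIV"
  using xi_law by (auto simp: has_law_def)

lemma measurable_eta: "n \<ge> 1 \<Longrightarrow> \<eta> n \<in> M \<rightarrow>\<^sub>M count_space UNIV"
  using eta_law by (auto simp: has_law_def)

lemma law_xi: "n \<ge> 1 \<Longrightarrow> law M (\<xi> n) = P"
  unfolding P_def by (rule has_law_imp_law_eq[OF prob_space_axioms prob_space_axioms xi_law xi_law]) auto

lemma has_law_Q: "prob_space L \<Longrightarrow> has_law L X q \<Longrightarrow> law L X = Q"
  unfolding Q_def by (intro has_law_imp_law_eq[OF _ prob_space_axioms _ eta_law]) auto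

lemma law_eta: "n \<ge> 1 \<Longrightarrow> law M (\<eta> n) = Q"
  by (intro has_law_Q prob_space_axioms eta_law)

lemma pmf_P: "pmf P z = p z"
  using xi_law[of 1]
  by (simp add: P_def pmf_law prob_space_axioms has_law_def del: split_paired_All)

lemma pmf_Q: "pmf Q z = q z"
  using eta_law[of 1]
  by (simp add: Q_def pmf_law prob_space_axioms has_law_def del: split_paired_All)

lemma set_Q: "set_pmf Q \<subseteq> quadrant"
proof
  fix z assume "z \<in> set_pmf Q"
  then have "q z \<noteq> 0" by (simp add: set_pmf_eq pmf_Q)
  then show "z \<in> quadrant"
    using q_support[of "fst z" "snd z"] by (cases z) (force simp: quadrant_def)
qed

text \<open>Interior coordinates are at least 1 and \<open>P\<close> steps at least -1, so a single
  step cannot jump over the boundary.\<close>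

lemma set_P:
  assumes "s \<in> quadrant_interior" "z \<in> set_pmf P"
  shows "s + z \<in> quadrant"
proof -
  have "p z \<noteq> 0" using assms(2) by (simp add: set_pmf_eq pmf_P)
  then show ?thesis
    using assms(1) p_support[of "fst z" "snd z"]
    by (cases z; cases s) (force simp: quadrant_def quadrant_interior_def)
qed

lemma measurable_state: "walk_state \<xi> \<eta> x T \<in> M \<rightarrow>\<^sub>M count_space UNIV"
  by (intro measurable_walk_state measurable_xi measurable_eta) auto

text \<open>The state at time \<open>T\<close> is a function of the drivers with index up to
  \<open>T\<close>, and the next pair of drivers occupies a disjoint set of indices in the jointly
  independent family.\<close>

lemma law_state_step:
  "law M (\<lambda>\<omega>. (walk_state \<xi> \<eta> x T \<omega>, (\<xi> (Suc T) \<omega>, \<eta> (Suc T) \<omega>))) =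
     pair_pmf (law M (walk_state \<xi> \<eta> x T)) (law M (\<lambda>\<omega>. (\<xi> (Suc T) \<omega>, \<eta> (Suc T) \<omega>)))"
proof -
  let ?A = "{1..T} <+> {1..T}" and ?B = "{Inl (Suc T), Inr (Suc T)} :: (nat + nat) set"
  let ?X = "case_sum \<xi> \<eta>"
  \<comment> \<open>The walk is run on the product space with the coordinates as drivers, which
    exhibits the state as a measurable function of the restricted family.\<close>
  let ?F = "walk_state (\<lambda>n w. w (Inl n)) (\<lambda>n w. w (Inr n)) x T :: (nat + nat \<Rightarrow> int \<times> int) \<Rightarrow> _"
  let ?G = "\<lambda>w :: nat + nat \<Rightarrow> int \<times> int. (w (Inl (Suc T)), w (Inr (Suc T)))"
  have F: "?F \<in> PiM ?A (\<lambda>_. count_space UNIV) \<rightarrow>\<^sub>M count_space UNIV"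
    by (intro measurable_walk_state measurable_component_singleton) auto
  have G: "?G \<in> PiM ?B (\<lambda>_. count_space UNIV) \<rightarrow>\<^sub>M count_space UNIV"
    by (intro measurable_count_space_compose2[where h = Pair] measurable_component_singleton) auto
  have "?F (restrict (\<lambda>i. ?X i \<omega>) ?A) = walk_state \<xi> \<eta> x T \<omega>" for \<omega>
    by (rule walk_state_cong) auto
  moreover have "indep_var (PiM ?A (\<lambda>_. count_space UNIV)) (\<lambda>\<omega>. restrict (\<lambda>i. ?X i \<omega>) ?A)
      (PiM ?B (\<lambda>_. count_space UNIV)) (\<lambda>\<omega>. restrict (\<lambda>i. ?X i \<omega>) ?B)"
    by (rule indep_var_restrict[OF indep]) auto
  from law_pair[OF prob_space_axioms this F G] calculation show ?thesis by simp
qed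

lemma law_state_Suc:
  "law M (walk_state \<xi> \<eta> x (Suc T)) = bind_pmf (law M (walk_state \<xi> \<eta> x T))
     (\<lambda>(s, c). map_pmf (\<lambda>y. (y, of_bool (s \<in> quadrant_boundary) + c)) (walk_step P Q s))"
proof -
  let ?J = "\<lambda>\<omega>. (\<xi> (Suc T) \<omega>, \<eta> (Suc T) \<omega>)"
  have J: "?J \<in> M \<rightarrow>\<^sub>M count_space UNIV"
    by (rule measurable_count_space_compose2[where h = Pair, OF measurable_xi measurable_eta]) simp_all
  have marginals: "map_pmf fst (law M ?J) = P" "map_pmf snd (law M ?J) = Q"
    using law_compose[OF prob_space_axioms J, of fst] law_compose[OF prob_space_axioms J, of snd]
    by (simp_all only: fst_conv snd_conv law_xi law_eta le_add1 plus_1_eq_Suc)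
  have "law M (walk_state \<xi> \<eta> x (Suc T)) =
      law M (\<lambda>\<omega>. case_prod update (walk_state \<xi> \<eta> x T \<omega>, ?J \<omega>))"
    by (rule arg_cong[where f = "law M"], rule ext) (simp add: walk_state_Suc)
  also have "\<dots> = map_pmf (case_prod update) (law M (\<lambda>\<omega>. (walk_state \<xi> \<eta> x T \<omega>, ?J \<omega>)))"
    by (intro law_compose prob_space_axioms
        measurable_count_space_compose2[where h = Pair] measurable_state J)
  also have "\<dots> = bind_pmf (law M (walk_state \<xi> \<eta> x T)) (\<lambda>s. map_pmf (update s) (law M ?J))"
    by (simp add: law_state_step pair_pmf_def map_bind_pmf
        bind_return_pmf map_pmf_def bind_assoc_pmf)
  also have "(\<lambda>s. map_pmf (update s) (law M ?J)) = (\<lambda>(s, c).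
      map_pmf (\<lambda>y. (y, of_bool (s \<in> quadrant_boundary) + c)) (walk_step P Q s))"
  proof
    fix s :: "(int \<times> int) \<times> nat"
    obtain z c where "s = (z, c)" by (rule prod.exhaust)
    then show "map_pmf (update s) (law M ?J) = (case s of (s, c) \<Rightarrow>
        map_pmf (\<lambda>y. (y, of_bool (s \<in> quadrant_boundary) + c)) (walk_step P Q s))"
      using map_update[OF marginals, of z c] by (simp only: prod.case)
  qed
  finally show ?thesis .
qed

lemma law_contacts_upto: "law M (contacts_upto \<xi> \<eta> x T) = visits P Q T x"
proof -
  \<comment> \<open>A forward run of \<open>T\<close> steps is followed by \<open>k\<close> steps in
    the first-step recursion. Induction on \<open>T\<close> hands the last forward step over to
    \<open>visits\<close>, which requires \<open>k\<close> to be arbitrary; \<open>k = 0\<close>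
    gives the claim.\<close>
  have *: "bind_pmf (law M (walk_state \<xi> \<eta> x T)) (\<lambda>(s, c). map_pmf (\<lambda>d. c + d) (visits P Q k s)) =
      visits P Q (T + k) x" for k
  proof (induction T arbitrary: k)
    case 0
    have "walk_state \<xi> \<eta> x 0 = (\<lambda>\<omega>. (x, 0))"
      by (auto simp: walk_state_def contacts_upto_def)
    then show ?case
      by (simp add: law_const[OF prob_space_axioms] bind_return_pmf map_pmf_plus_0)
  next
    case (Suc T)
    have plus_Suc: "(+) (Suc c) = (\<lambda>d. Suc (c + d))" for c
      by auto
    have "bind_pmf (law M (walk_state \<xi> \<eta> x (Suc T)))
        (\<lambda>(s, c). map_pmf (\<lambda>d. c + d) (visits P Q k s)) =
        bind_pmf (law M (walk_state \<xi> \<eta> x T)) (\<lambda>(s, c). map_pmf (\<lambda>d. c + d) (visits P Q (Suc k) s))"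
      unfolding law_state_Suc bind_assoc_pmf
      by (intro bind_pmf_cong refl)
         (auto simp: bind_map_pmf map_bind_pmf pmf.map_comp o_def ac_simps plus_Suc)
    then show ?case using Suc[of "Suc k"] by simp
  qed
  have "law M (contacts_upto \<xi> \<eta> x T) = law M (\<lambda>\<omega>. snd (walk_state \<xi> \<eta> x T \<omega>))"
    by (rule arg_cong[where f = "law M"], rule ext) (simp add: walk_state_def)
  also have "\<dots> = map_pmf snd (law M (walk_state \<xi> \<eta> x T))"
    by (rule law_compose[OF prob_space_axioms measurable_state])
  also have "\<dots> = visits P Q T x"
    using *[of 0] by (simp add: map_pmf_def case_prod_unfold bind_return_pmf)
  finally show ?thesis .
qed

section \<open>The distribution function of the total number of contacts\<close>

lemma measurable_contacts_upto: "contacts_upto \<xi> \<eta> x T \<in> M \<rightarrow>\<^sub>M count_space UNIV"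
  using measurable_compose[OF measurable_state[of x T], of snd "count_space UNIV"]
  by (simp add: walk_state_def)

lemma sets_contacts_upto_le: "{\<omega> \<in> space M. contacts_upto \<xi> \<eta> x T \<omega> \<le> n} \<in> events"
  using measurable_sets[OF measurable_contacts_upto[of x T], of "{..n}"]
  by (simp add: vimage_def Int_def conj_commute)

lemma sets_contacts_le: "{\<omega> \<in> space M. contacts \<xi> \<eta> x \<omega> \<le> enat n} \<in> events"
  unfolding contacts_le_iff using sets_contacts_upto_le by (intro sets.sets_Collect_countable_All) auto

text \<open>Truncated subtraction merges the values 0 and 1 but respects the events "at most
  \<open>m\<close>". So the distribution function shifts exactly, whereas the point probabilities
  need a correction at 1.\<close>

definition contact_cdf :: "nat \<Rightarrow> int \<times> int \<Rightarrow> real" where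
  "contact_cdf n x = prob {\<omega> \<in> space M. contacts \<xi> \<eta> x \<omega> \<le> enat n}"

text \<open>Counts grow with the horizon, so the events decrease to their intersection and
  continuity from above applies.\<close>

lemma visits_tendsto_contact_cdf:
  "(\<lambda>T. measure_pmf.prob (visits P Q T x) {..n}) \<longlonglongrightarrow> contact_cdf n x"
proof -
  let ?A = "\<lambda>T. {\<omega> \<in> space M. contacts_upto \<xi> \<eta> x T \<omega> \<le> n}"
  have "decseq ?A"
  proof (rule decseq_SucI)
    fix T
    show "?A (Suc T) \<le> ?A T"
      by (auto simp: contacts_upto_def)
  qed
  then have "(\<lambda>T. prob (?A T)) \<longlonglongrightarrow> prob (\<Inter>T. ?A T)"
    using sets_contacts_upto_le[of x _ n] by (intro finite_Lim_measure_decseq) auto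
  moreover have "(\<Inter>T. ?A T) = {\<omega> \<in> space M. contacts \<xi> \<eta> x \<omega> \<le> enat n}"
    by (auto simp: contacts_le_iff)
  moreover have "prob (?A T) = measure_pmf.prob (visits P Q T x) {..n}" for T
    by (simp add: measure_law[OF prob_space_axioms measurable_contacts_upto]
        flip: law_contacts_upto)
  ultimately show ?thesis by (simp add: contact_cdf_def)
qed

lemma contact_cdf_shift:
  assumes "x \<in> quadrant"
  shows "contact_cdf (m + n) x =
    measure_pmf.expectation (conv_power Q n) (\<lambda>y. contact_cdf m (x + y))"
proof (rule LIMSEQ_unique)
  show "(\<lambda>T. measure_pmf.prob (visits P Q (T + n) x) {..m + n}) \<longlonglongrightarrow> contact_cdf (m + n) x"
    by (rule LIMSEQ_ignore_initial_segment[OF visits_tendsto_contact_cdf])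
  have "measure_pmf.prob (visits P Q (T + n) x) {..m + n} =
      measure_pmf.expectation (conv_power Q n) (\<lambda>y. measure_pmf.prob (visits P Q T (x + y)) {..m})" for T
  proof -
    \<comment> \<open>For truncated subtraction, \<open>c - n\<close> is at most \<open>m\<close>
      exactly when \<open>c\<close> is at most \<open>m + n\<close>.\<close>
    have "measure_pmf.prob (visits P Q (T + n) x) {..m + n} =
        measure_pmf.prob (map_pmf (\<lambda>c. c - n) (visits P Q (T + n) x)) {..m}"
      by (auto simp: intro!: arg_cong[where f = "measure_pmf.prob _"])
    then show ?thesis
      by (simp add: visits_shift_power[OF set_P set_Q assms] prob_bind_pmf)
  qed
  moreover have "(\<lambda>T. measure_pmf.expectation (conv_power Q n)
      (\<lambda>y. measure_pmf.prob (visits P Q T (x + y)) {..m})) \<longlonglongrightarrow>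
      measure_pmf.expectation (conv_power Q n) (\<lambda>y. contact_cdf m (x + y))"
    \<comment> \<open>Probabilities are bounded by 1, which is integrable, so the limit in
      \<open>T\<close> passes under the expectation.\<close>
    by (rule integral_dominated_convergence[where w = "\<lambda>_. 1"])
       (auto intro: visits_tendsto_contact_cdf)
  ultimately show "(\<lambda>T. measure_pmf.prob (visits P Q (T + n) x) {..m + n}) \<longlonglongrightarrow>
      measure_pmf.expectation (conv_power Q n) (\<lambda>y. contact_cdf m (x + y))"
    by simp
qed

lemma contact_cdf_Suc:
  assumes "x \<in> quadrant"
  shows "contact_cdf (Suc n) x = measure_pmf.expectation Q (\<lambda>y. contact_cdf n (x + y))"
  using contact_cdf_shift[OF assms, of n 1] by (simp add: bind_return_pmf map_pmf_plus_0)

lemma contact_prob_0: "contact_prob M \<xi> \<eta> 0 x = contact_cdf 0 x"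
  by (simp add: contact_prob_def contact_cdf_def flip: zero_enat_def)

lemma contact_prob_Suc: "contact_prob M \<xi> \<eta> (Suc n) x = contact_cdf (Suc n) x - contact_cdf n x"
proof -
  have "{\<omega> \<in> space M. contacts \<xi> \<eta> x \<omega> = enat (Suc n)} =
      {\<omega> \<in> space M. contacts \<xi> \<eta> x \<omega> \<le> enat (Suc n)} - {\<omega> \<in> space M. contacts \<xi> \<eta> x \<omega> \<le> enat n}"
    (is "_ = ?A - ?B")
  proof -
    have "e = enat (Suc n) \<longleftrightarrow> e \<le> enat (Suc n) \<and> \<not> e \<le> enat n" for e
      by (cases e) auto
    then show ?thesis by auto
  qed
  moreover have "?B \<subseteq> ?A"
    by (auto intro: order_trans[where y = "enat n"])
  ultimately show ?thesis
    unfolding contact_prob_def contact_cdf_def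
    by (simp add: finite_measure_Diff sets_contacts_le)
qed

lemma sum_contact_prob: "(\<Sum>k=0..n. contact_prob M \<xi> \<eta> k x) = contact_cdf n x"
  by (induction n) (simp_all add: contact_prob_0 contact_prob_Suc)

lemma integrable_contact_cdf: "integrable (measure_pmf R) (\<lambda>y. contact_cdf n (x + y))"
  by (intro measure_pmf.integrable_const_bound[where B = 1]) (auto simp: contact_cdf_def)

text \<open>In the difference of distribution functions at 1 and 0, only the first term is a shift;
  the second is \<open>f_0\<close> itself. This is the extra term of the first identity.\<close>

lemma contact_prob_1:
  assumes "x \<in> quadrant"
  shows "contact_prob M \<xi> \<eta> 1 x =
    measure_pmf.expectation Q (\<lambda>y. contact_prob M \<xi> \<eta> 0 (x + y)) - contact_prob M \<xi> \<eta> 0 x"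
  by (simp add: contact_prob_0 contact_prob_Suc contact_cdf_Suc[OF assms])

text \<open>For positive \<open>n\<close> both distribution functions in the difference are shifts,
  so the two expectations combine into one.\<close>

lemma contact_prob_recursion:
  assumes "x \<in> quadrant" "n \<ge> 1"
  shows "contact_prob M \<xi> \<eta> (n + 1) x =
    measure_pmf.expectation Q (\<lambda>y. contact_prob M \<xi> \<eta> n (x + y))"
proof -
  obtain m where "n = Suc m" using assms(2) by (cases n) auto
  then show ?thesis
    by (simp add: contact_prob_Suc contact_cdf_Suc[OF assms(1)] integrable_contact_cdf)
qed

end

section \<open>Sums of independent reflection steps and transfer between probability spaces\<close>

lemma law_sum:
  fixes \<zeta> :: "nat \<Rightarrow> 'a \<Rightarrow> 'b::{countable, comm_monoid_add}"
  assumes L: "prob_space L"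
    and indep: "prob_space.indep_vars L (\<lambda>_. count_space UNIV) \<zeta> {1..}"
    and law: "\<And>k. k \<ge> 1 \<Longrightarrow> law L (\<zeta> k) = Q"
  shows "(\<lambda>\<omega>. \<Sum>k=1..n. \<zeta> k \<omega>) \<in> L \<rightarrow>\<^sub>M count_space UNIV \<and>
    law L (\<lambda>\<omega>. \<Sum>k=1..n. \<zeta> k \<omega>) = conv_power Q n"
proof (induction n)
  case 0
  then show ?case by (simp add: law_const[OF L])
next
  case (Suc n)
  interpret prob_space L by fact
  let ?F = "\<lambda>w :: nat \<Rightarrow> 'b. \<Sum>k=1..n. w k" and ?G = "\<lambda>w :: nat \<Rightarrow> 'b. w (Suc n)"
  \<comment> \<open>The number of summands varies while the product space stays fixed, so that the
    induction does not change the domain.\<close>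
  have sum_measurable:
    "(\<lambda>w :: nat \<Rightarrow> 'b. \<Sum>k=1..m. w k) \<in> PiM {1..n} (\<lambda>_. count_space UNIV) \<rightarrow>\<^sub>M count_space UNIV"
    if "m \<le> n" for m
    using that
  proof (induction m)
    case (Suc m)
    then have S: "(\<lambda>w :: nat \<Rightarrow> 'b. \<Sum>k=1..m. w k) \<in> PiM {1..n} (\<lambda>_. count_space UNIV) \<rightarrow>\<^sub>M count_space UNIV"
      by simp
    have C: "(\<lambda>w :: nat \<Rightarrow> 'b. w (Suc m)) \<in> PiM {1..n} (\<lambda>_. count_space UNIV) \<rightarrow>\<^sub>M count_space UNIV"
      using Suc.prems by (intro measurable_component_singleton) auto
    show ?case
      using measurable_count_space_compose2[OF S C, of "(+)"] by simp
  qed simp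
  \<comment> \<open>The index blocks \<open>{1..n}\<close> and \<open>{Suc n}\<close> are disjoint,
    so the partial sum is independent of the next summand.\<close>
  have "indep_var (count_space UNIV) (?F \<circ> (\<lambda>\<omega>. restrict (\<lambda>i. \<zeta> i \<omega>) {1..n}))
      (count_space UNIV) (?G \<circ> (\<lambda>\<omega>. restrict (\<lambda>i. \<zeta> i \<omega>) {Suc n}))"
    by (rule indep_var_compose[OF indep_var_restrict[OF indep] sum_measurable
          measurable_component_singleton]) auto
  then have ind: "indep_var (count_space UNIV) (\<lambda>\<omega>. \<Sum>k=1..n. \<zeta> k \<omega>) (count_space UNIV) (\<zeta> (Suc n))"
    by (simp add: o_def)
  have meas: "(\<lambda>\<omega>. (\<Sum>k=1..n. \<zeta> k \<omega>, \<zeta> (Suc n) \<omega>)) \<in> L \<rightarrow>\<^sub>M count_space UNIV"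
    by (intro measurable_count_space_compose2[where h = Pair] indep_var_rv1[OF ind]
        indep_var_rv2[OF ind])
  have pair: "law L (\<lambda>\<omega>. (\<Sum>k=1..n. \<zeta> k \<omega>, \<zeta> (Suc n) \<omega>)) =
      pair_pmf (law L (\<lambda>\<omega>. \<Sum>k=1..n. \<zeta> k \<omega>)) (law L (\<zeta> (Suc n)))"
    using law_pair[OF L ind, of id id] by simp
  have eq: "(\<lambda>\<omega>. \<Sum>k=1..Suc n. \<zeta> k \<omega>) =
      (\<lambda>\<omega>. case_prod (+) (\<Sum>k=1..n. \<zeta> k \<omega>, \<zeta> (Suc n) \<omega>))"
    by auto
  have "law L (\<lambda>\<omega>. \<Sum>k=1..Suc n. \<zeta> k \<omega>) = map_pmf (case_prod (+)) (pair_pmf (conv_power Q n) Q)"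
    unfolding eq law_compose[OF L meas] pair using Suc law[of "Suc n"] by simp
  also have "\<dots> = conv_power Q (Suc n)"
    by (simp add: pair_pmf_def map_bind_pmf bind_return_pmf map_pmf_def bind_assoc_pmf)
  finally show ?case
    unfolding eq using measurable_compose[OF meas, of "case_prod (+)" "count_space UNIV"] by simp
qed

theorem theorem2:
  fixes M :: "'a measure" and N :: "'b measure" and L :: "'c measure"
    and p q :: "int \<times> int \<Rightarrow> real"
    and \<xi> \<eta> :: "nat \<Rightarrow> 'a \<Rightarrow> int \<times> int"
    and \<eta>' :: "'b \<Rightarrow> int \<times> int"
    and \<zeta> :: "nat \<Rightarrow> 'c \<Rightarrow> int \<times> int"
    and f :: "nat \<Rightarrow> int \<times> int \<Rightarrow> real"
  defines "f \<equiv> contact_prob M \<xi> \<eta>"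
  assumes walk: "reflected_quadrant_walk M p q \<xi> \<eta>"
    and step: "prob_space N" "has_law N \<eta>' q"
  shows "(\<forall>x\<in>quadrant.
            f 1 x = prob_space.expectation N (\<lambda>\<omega>. f 0 (x + \<eta>' \<omega>)) - f 0 x \<and>
            (\<forall>n\<ge>1. f (n + 1) x = prob_space.expectation N (\<lambda>\<omega>. f n (x + \<eta>' \<omega>)))) \<and>
         (prob_space L \<and>
          prob_space.indep_vars L (\<lambda>_. count_space UNIV) \<zeta> {1..} \<and>
          (\<forall>k\<ge>1. has_law L (\<zeta> k) q) \<longrightarrow>
          (\<forall>n\<ge>1. \<forall>x\<in>quadrant.
            measure M {\<omega> \<in> space M. contacts \<xi> \<eta> x \<omega> \<le> enat n} = (\<Sum>k=0..n. f k x) \<and>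
            (\<Sum>k=0..n. f k x) =
              prob_space.expectation L (\<lambda>\<omega>. f 0 (x + (\<Sum>k=1..n. \<zeta> k \<omega>)))))"
proof -
  interpret reflected_quadrant_walk M p q \<xi> \<eta> by (rule walk)
  \<comment> \<open>The spaces \<open>N\<close> and \<open>M\<close> are unrelated; they meet only
    in the common law \<open>Q\<close>.\<close>
  have expect: "prob_space.expectation N (\<lambda>\<omega>. f n (x + \<eta>' \<omega>)) =
      measure_pmf.expectation Q (\<lambda>y. f n (x + y))" for n x
    using integral_law[OF step(1), of \<eta>' "\<lambda>y. f n (x + y)"] step(2) has_law_Q[OF step]
    by (simp add: has_law_def)
  \<comment> \<open>The left side telescopes to the distribution function at \<open>n\<close>;
    shifting it down to level 0, where it equals \<open>f 0\<close>, uses up all \<open>n\<close>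
    reflections.\<close>
  have "(\<Sum>k=0..n. f k x) = prob_space.expectation L (\<lambda>\<omega>. f 0 (x + (\<Sum>k=1..n. \<zeta> k \<omega>)))"
    if L: "prob_space L" and indep: "prob_space.indep_vars L (\<lambda>_. count_space UNIV) \<zeta> {1..}"
      and law: "\<forall>k\<ge>1. has_law L (\<zeta> k) q" and x: "x \<in> quadrant" for n x
  proof -
    have "(\<lambda>\<omega>. \<Sum>k=1..n. \<zeta> k \<omega>) \<in> L \<rightarrow>\<^sub>M count_space UNIV"
      and sum: "law L (\<lambda>\<omega>. \<Sum>k=1..n. \<zeta> k \<omega>) = conv_power Q n"
      using law_sum[OF L indep, of Q n] law has_law_Q[OF L] by auto
    from integral_law[OF L this(1), of "\<lambda>y. f 0 (x + y)"]
    show ?thesis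
      using contact_cdf_shift[OF x, of 0 n]
      by (simp only: sum f_def sum_contact_prob contact_prob_0 add_0)
  qed
  then show ?thesis
    using contact_prob_1 contact_prob_recursion sum_contact_prob
    unfolding expect by (auto simp: f_def contact_cdf_def)
qed

end
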